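(* Let $\mathcal{F}=\{\mathbb{X};\,f_1,\dots,f_N\}$ be an iterated function system on a complete metric space $\mathbb{X}$ and let $A$ be a point-fibred attractor of $\mathcal{F}$. If $\widehat{B}$ is the fast basin of $A$ and $\{B_\theta : \theta\in\mathbb{I}_+\}$ is the set of continuations of $A$, then $$\widehat{B}=\bigcup_{\theta\in\mathbb{I}_+}B_\theta .$$
   Context: An iterated function system (IFS) $\mathcal{F}=\{\mathbb{X};\,f_1,\dots,f_N\}$ is a complete metric space $(\mathbb{X},d_{\mathbb{X}})$ together with finitely many homeomorphisms $f_n:\mathbb{X}\to\mathbb{X}$ of $\mathbb{X}$ onto itself. $H$ is the set of nonempty compact subsets of $\mathbb{X}$ with the Hausdorff metric. For $S\subset\mathbb{X}$, $F(S)=\bigcup_{n=1}^N f_n(S)$, and $F^k$ is the $k$-fold iterate of $F$, $F^0(S)=S$. An attractor of $\mathcal{F}$ is a set $A\in H$ with $F(A)=A$ for which there is an open set $U\supset A$ such that $F^k(C)\to A$ in the Hausdorff metric for every $C\in H$ with $C\subset U$. The union of all such open sets $U$ is the basin $B(A)$ of $A$ (the defining property also holds with $U=B(A)$). $I_+=\{1,\dots,N\}$ and $\mathbb{I}_+=I_+^{\infty}$ (infinite words, indexed by $\{1,2,\dots\}$). For $\iota\in\mathbb{I}_+$, $f_{\iota|k}=f_{\iota_1}\circ\cdots\circ f_{\iota_k}$. The attractor $A$ is point-fibred if for every $\iota\in\mathbb{I}_+$ the limit $\lim_{k\to\infty}f_{\iota|k}(C)$ exists in the Hausdorff metric for all $C\in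 H$ with $C\subset B(A)$, is a singleton subset of $A$, and is independent of $C$. The fast basin of $A$ is $\widehat{B}=\{x\in\mathbb{X}: F^K(\{x\})\cap A\neq\varnothing \text{ for some } K\in\mathbb{N}\}$, with $\mathbb{N}=\{1,2,3,\dots\}$. For $\theta\in\mathbb{I}_+$ the continuation $B_\theta$ of $A$ is $$B_\theta=A\cup\bigcup_{k\in\mathbb{N}}f_{\theta_1}^{-1}\circ f_{\theta_2}^{-1}\circ\cdots\circ f_{\theta_k}^{-1}(A).$$ *)

theory Defs
  imports "HOL-Analysis.Analysis"
begin

text \<open>The underlying complete metric space is a type of class \<open>complete_space\<close>. The maps
  $f_1,\dots,f_N$ are given by \<open>f :: nat \<Rightarrow> 'a \<Rightarrow> 'a\<close>, of which only the values at indices in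
  \<open>{1..N}\<close> are ever used.\<close>

definition is_ifs :: "nat \<Rightarrow> (nat \<Rightarrow> 'a::complete_space \<Rightarrow> 'a) \<Rightarrow> bool" where
  "is_ifs N f \<longleftrightarrow> (\<forall>n\<in>{1..N}. homeomorphism UNIV UNIV (f n) (inv (f n)))"

definition nonempty_compacts :: "'a::metric_space set set" where
  "nonempty_compacts = {C. compact C \<and> C \<noteq> {}}"

text \<open>The suprema are suprema of reals, hence only meaningful for nonempty bounded sets; the
  distance is used on nonempty compact sets only.\<close>

definition hausdorff_dist :: "'a::metric_space set \<Rightarrow> 'a set \<Rightarrow> real" where
  "hausdorff_dist S T = max (SUP x\<in>S. infdist x T) (SUP y\<in>T. infdist y S)"

definition hausdorff_limit :: "(nat \<Rightarrow> 'a::metric_space set) \<Rightarrow> 'a set \<Rightarrow> bool" where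
  "hausdorff_limit S T \<longleftrightarrow> (\<lambda>k. hausdorff_dist (S k) T) \<longlonglongrightarrow> 0"

definition ifs_map :: "nat \<Rightarrow> (nat \<Rightarrow> 'a \<Rightarrow> 'a) \<Rightarrow> 'a set \<Rightarrow> 'a set" where
  "ifs_map N f S = (\<Union>n\<in>{1..N}. f n ` S)"

definition attracting_nbhd ::
    "nat \<Rightarrow> (nat \<Rightarrow> 'a::complete_space \<Rightarrow> 'a) \<Rightarrow> 'a set \<Rightarrow> 'a set \<Rightarrow> bool" where
  "attracting_nbhd N f A U \<longleftrightarrow> open U \<and> A \<subseteq> U \<and>
     (\<forall>C\<in>nonempty_compacts. C \<subseteq> U \<longrightarrow> hausdorff_limit (\<lambda>k. (ifs_map N f ^^ k) C) A)"

definition is_attractor :: "nat \<Rightarrow> (nat \<Rightarrow> 'a::complete_space \<Rightarrow> 'a) \<Rightarrow> 'a set \<Rightarrow> bool" where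
  "is_attractor N f A \<longleftrightarrow>
     A \<in> nonempty_compacts \<and> ifs_map N f A = A \<and> (\<exists>U. attracting_nbhd N f A U)"

definition basin :: "nat \<Rightarrow> (nat \<Rightarrow> 'a::complete_space \<Rightarrow> 'a) \<Rightarrow> 'a set \<Rightarrow> 'a set" where
  "basin N f A = \<Union> {U. attracting_nbhd N f A U}"

text \<open>Infinite words have letters at positions $1, 2, \dots$; extensionality fixes the
  value at position 0, which is not part of the word.\<close>

definition infinite_words :: "nat \<Rightarrow> (nat \<Rightarrow> nat) set" where
  "infinite_words N = {1..} \<rightarrow>\<^sub>E {1..N}"

text \<open>\<open>word_comp g \<iota> k\<close> is $g_{\iota_1} \circ \dots \circ g_{\iota_k}$.\<close>

primrec word_comp :: "(nat \<Rightarrow> 'a \<Rightarrow> 'a) \<Rightarrow> (nat \<Rightarrow> nat) \<Rightarrow> nat \<Rightarrow> 'a \<Rightarrow> 'a" where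
  "word_comp g \<iota> 0 = id"
| "word_comp g \<iota> (Suc k) = word_comp g \<iota> k \<circ> g (\<iota> (Suc k))"

text \<open>The point \<open>a\<close> is chosen before \<open>C\<close>: the limit does not depend on \<open>C\<close>.\<close>

definition point_fibred :: "nat \<Rightarrow> (nat \<Rightarrow> 'a::complete_space \<Rightarrow> 'a) \<Rightarrow> 'a set \<Rightarrow> bool" where
  "point_fibred N f A \<longleftrightarrow>
     (\<forall>\<iota>\<in>infinite_words N. \<exists>a\<in>A. \<forall>C\<in>nonempty_compacts. C \<subseteq> basin N f A \<longrightarrow>
        hausdorff_limit (\<lambda>k. word_comp f \<iota> k ` C) {a})"

definition fast_basin :: "nat \<Rightarrow> (nat \<Rightarrow> 'a \<Rightarrow> 'a) \<Rightarrow> 'a set \<Rightarrow> 'a set" where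
  "fast_basin N f A = {x. \<exists>K\<ge>1. (ifs_map N f ^^ K) {x} \<inter> A \<noteq> {}}"

definition continuation :: "(nat \<Rightarrow> 'a \<Rightarrow> 'a) \<Rightarrow> 'a set \<Rightarrow> (nat \<Rightarrow> nat) \<Rightarrow> 'a set" where
  "continuation f A \<theta> = A \<union> (\<Union>k\<in>{1..}. word_comp (\<lambda>n. inv (f n)) \<theta> k ` A)"

end

theory Submission
  imports Defs
begin

text \<open>A point \<open>y\<close> lies in \<open>F^k({x})\<close> exactly when it is reached from
  \<open>x\<close> by applying maps with letters \<theta>_1, ..., \<theta>_k in this order. Since
  the maps are bijections, this can be solved for \<open>x\<close>: undoing \<theta>_k first and
  \<theta>_1 last gives the composition of inverses that defines a continuation
  (\<open>mem_ifs_map_power_singleton_iff\<close>). Letting \<open>y\<close> range over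
  \<open>A\<close> and \<open>k\<close> over the positive integers turns the fast basin into the
  union of all inverse images in the continuations. The extra summand \<open>A\<close> of each
  continuation adds nothing, because \<open>A\<close> lies in the fast basin
  (\<open>subset_fast_basin\<close>).\<close>

lemma is_ifs_bij:
  assumes "is_ifs N f" "n \<in> {1..N}"
  shows "bij (f n)"
proof -
  have "homeomorphism UNIV UNIV (f n) (inv (f n))" using assms by (simp add: is_ifs_def)
  then show ?thesis
    by (intro o_bij[of "inv (f n)"]) (auto simp: homeomorphism_def fun_eq_iff)
qed

lemma word_comp_cong:
  assumes "\<And>i. i \<in> {1..k} \<Longrightarrow> \<theta> i = \<theta>' i"
  shows "word_comp g \<theta> k = word_comp g \<theta>' k"
  using assms by (induction k) auto

lemma infinite_words_nonempty:
  assumes "1 \<le> N"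
  shows "infinite_words N \<noteq> {}"
  using assms by (auto simp: infinite_words_def PiE_eq_empty_iff)

lemma infinite_words_letter:
  assumes "\<theta> \<in> infinite_words N" "1 \<le> i"
  shows "\<theta> i \<in> {1..N}"
  using assms PiE_mem[of \<theta> "{1..}" "\<lambda>_. {1..N}" i] by (simp add: infinite_words_def)

lemma infinite_words_fun_upd:
  assumes "\<theta> \<in> infinite_words N" "1 \<le> i" "n \<in> {1..N}"
  shows "\<theta>(i := n) \<in> infinite_words N"
  using assms unfolding infinite_words_def by (auto simp: PiE_iff extensional_def)

text \<open>Induction on \<open>k\<close>: the map applied last is the one undone first, and
  \<open>word_comp\<close> appends its new letter innermost, so one more application of
  \<open>F\<close> matches one more letter. Injectivity gives the forward direction, surjectivity
  the converse.\<close>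

lemma mem_ifs_map_power_singleton_iff:
  assumes bij: "\<And>n. n \<in> {1..N} \<Longrightarrow> bij (f n)" and N: "1 \<le> N"
  shows "y \<in> (ifs_map N f ^^ k) {x} \<longleftrightarrow>
    (\<exists>\<theta>\<in>infinite_words N. x = word_comp (\<lambda>n. inv (f n)) \<theta> k y)"
proof (induction k arbitrary: y)
  case 0
  \<comment> \<open>Both sides reduce to \<open>x = y\<close>, the right one only because some word
    exists.\<close>
  show ?case using infinite_words_nonempty[OF N] by auto
next
  case (Suc k)
  show ?case
  proof
    assume "y \<in> (ifs_map N f ^^ Suc k) {x}"
    then obtain n z where n: "n \<in> {1..N}" and z: "z \<in> (ifs_map N f ^^ k) {x}" and y: "y = f n z"
      by (auto simp: ifs_map_def)
    from z Suc.IH obtain \<theta> where \<theta>: "\<theta> \<in> infinite_words N"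
      and x: "x = word_comp (\<lambda>n. inv (f n)) \<theta> k z" by blast
    \<comment> \<open>Position \<open>Suc k\<close> lies beyond the first \<open>k\<close> letters,
      so it is free to record \<open>n\<close>.\<close>
    have "word_comp (\<lambda>n. inv (f n)) \<theta> k = word_comp (\<lambda>n. inv (f n)) (\<theta>(Suc k := n)) k"
      by (rule word_comp_cong) auto
    moreover have "inv (f n) y = z" using bij[OF n] y by (simp add: bij_is_inj)
    ultimately have "x = word_comp (\<lambda>n. inv (f n)) (\<theta>(Suc k := n)) (Suc k) y" using x by simp
    moreover have "\<theta>(Suc k := n) \<in> infinite_words N" using infinite_words_fun_upd[OF \<theta> _ n] by simp
    ultimately show "\<exists>\<theta>\<in>infinite_words N. x = word_comp (\<lambda>n. inv (f n)) \<theta> (Suc k) y" by (rule bexI)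
  next
    assume "\<exists>\<theta>\<in>infinite_words N. x = word_comp (\<lambda>n. inv (f n)) \<theta> (Suc k) y"
    then obtain \<theta> where \<theta>: "\<theta> \<in> infinite_words N"
      and x: "x = word_comp (\<lambda>n. inv (f n)) \<theta> k (inv (f (\<theta> (Suc k))) y)" by auto
    have n: "\<theta> (Suc k) \<in> {1..N}" using infinite_words_letter[OF \<theta>] by simp
    have "f (\<theta> (Suc k)) (inv (f (\<theta> (Suc k))) y) = y"
      using bij[OF n] by (simp add: bij_is_surj surj_f_inv_f)
    moreover have "inv (f (\<theta> (Suc k))) y \<in> (ifs_map N f ^^ k) {x}" using Suc.IH \<theta> x by blast
    ultimately have "y \<in> f (\<theta> (Suc k)) ` (ifs_map N f ^^ k) {x}" by (metis imageI)
    then have "y \<in> ifs_map N f ((ifs_map N f ^^ k) {x})"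
      unfolding ifs_map_def[of N f "(ifs_map N f ^^ k) {x}"] using n by blast
    then show "y \<in> (ifs_map N f ^^ Suc k) {x}" by simp
  qed
qed

text \<open>The fast basin demands at least one step, so membership in \<open>A\<close> alone is not
  enough; applying \<open>f 1\<close> provides a step that stays in \<open>A\<close>.\<close>

lemma subset_fast_basin:
  assumes "1 \<le> N" "ifs_map N f A \<subseteq> A"
  shows "A \<subseteq> fast_basin N f A"
proof
  fix x assume "x \<in> A"
  have "f 1 x \<in> ifs_map N f {x}" using assms(1) by (auto simp: ifs_map_def)
  moreover have "f 1 x \<in> ifs_map N f A" using assms(1) \<open>x \<in> A\<close> by (auto simp: ifs_map_def)
  ultimately have "(ifs_map N f ^^ 1) {x} \<inter> A \<noteq> {}" using assms(2) by auto
  then show "x \<in> fast_basin N f A" unfolding fast_basin_def by blast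
qed

theorem proposition2p7:
  fixes N :: nat and f :: "nat \<Rightarrow> 'a::complete_space \<Rightarrow> 'a" and A :: "'a set"
  assumes "is_ifs N f"
    and "is_attractor N f A"
    and "point_fibred N f A"
  shows "fast_basin N f A = (\<Union>\<theta>\<in>infinite_words N. continuation f A \<theta>)"
proof -
  have A: "ifs_map N f A = A" "A \<noteq> {}"
    using assms(2) by (auto simp: is_attractor_def nonempty_compacts_def)
  \<comment> \<open>For \<open>N = 0\<close> the image \<open>F(A)\<close> would be empty, yet it
    equals the nonempty set \<open>A\<close>.\<close>
  then have N: "1 \<le> N" by (cases N) (auto simp: ifs_map_def)
  have mem_iff: "y \<in> (ifs_map N f ^^ k) {x} \<longleftrightarrow>
    (\<exists>\<theta>\<in>infinite_words N. x = word_comp (\<lambda>n. inv (f n)) \<theta> k y)" for x y k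
    by (rule mem_ifs_map_power_singleton_iff[OF is_ifs_bij[OF assms(1)] N])
  have "fast_basin N f A = (\<Union>\<theta>\<in>infinite_words N. \<Union>k\<in>{1..}. word_comp (\<lambda>n. inv (f n)) \<theta> k ` A)"
    (is "_ = ?U")
  proof (rule set_eqI)
    fix x
    have "x \<in> fast_basin N f A \<longleftrightarrow> (\<exists>k\<ge>1. \<exists>y\<in>A. y \<in> (ifs_map N f ^^ k) {x})"
      unfolding fast_basin_def by blast
    also have "\<dots> \<longleftrightarrow> (\<exists>k\<ge>1. \<exists>y\<in>A. \<exists>\<theta>\<in>infinite_words N. x = word_comp (\<lambda>n. inv (f n)) \<theta> k y)"
      by (simp only: mem_iff)
    also have "\<dots> \<longleftrightarrow> x \<in> ?U" by blast
    finally show "x \<in> fast_basin N f A \<longleftrightarrow> x \<in> ?U" .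
  qed
  moreover have "A \<subseteq> fast_basin N f A" using subset_fast_basin[OF N, of f A] A(1) by simp
  ultimately show ?thesis
    \<comment> \<open>The union of the constant summand \<open>A\<close> over all words is
      \<open>A\<close>, as words exist; it is then absorbed.\<close>
    unfolding continuation_def UN_Un_distrib using infinite_words_nonempty[OF N]
    by (simp add: Un_absorb1)
qed

end
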